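(* Let $D$ be a non-empty finite set of negative integers and let $M$ be the minimum integer in $D$. Then $D$ is the signed degree set of some connected signed graph, and the minimum order (number of vertices) of such a graph, i.e. of a connected signed graph whose signed degree set is $D$, is $|M|+1$.
   Context: All graphs are finite, undirected, without loops and multiple edges. A signed graph is a graph in which each edge is assigned a positive or a negative sign. The signed degree of a vertex $v$ in a signed graph $G$, denoted $\mathrm{sdeg}(v)$, is the number of positive edges incident with $v$ minus the number of negative edges incident with $v$. The signed degree set of a signed graph $G$ is the set of distinct signed degrees of the vertices of $G$, i.e. $\{\mathrm{sdeg}(v) : v \in V(G)\}$. A signed graph is connected if its underlying graph (forgetting signs) is connected. *)

theory Defs
  imports "Graph_Theory.Digraph_Component"
begin

datatype edge_sign = Positive | Negative

text \<open>
  The underlying graph is represented as in \<open>Graph_Theory\<close>: a finite loop-free symmetric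
  digraph whose arcs are pairs of vertices (\<^locale>\<open>pair_graph\<close>).  An undirected edge is thus a
  pair of opposite arcs.  The sign is a function on unordered edges \<open>{u, v}\<close>, so that opposite
  arcs carry the same sign by construction; its values at sets that are not edges are irrelevant.
\<close>

record 'a signed_graph =
  underlying :: "'a pair_pre_digraph"
  sign :: "'a set \<Rightarrow> edge_sign"

definition is_signed_graph :: "'a signed_graph \<Rightarrow> bool" where
  "is_signed_graph S \<longleftrightarrow> pair_graph (underlying S)"

definition vertices :: "'a signed_graph \<Rightarrow> 'a set" where
  "vertices S = pverts (underlying S)"

definition edges :: "'a signed_graph \<Rightarrow> 'a set set" where
  "edges S = {{u, v} | u v. (u, v) \<in> parcs (underlying S)}"

definition graph_order :: "'a signed_graph \<Rightarrow> nat" where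
  "graph_order S = card (vertices S)"

definition sdeg :: "'a signed_graph \<Rightarrow> 'a \<Rightarrow> int" where
  "sdeg S v = int (card {e \<in> edges S. v \<in> e \<and> sign S e = Positive})
            - int (card {e \<in> edges S. v \<in> e \<and> sign S e = Negative})"

definition signed_degree_set :: "'a signed_graph \<Rightarrow> int set" where
  "signed_degree_set S = sdeg S ` vertices S"

text \<open>
  Connectedness in \<open>Graph_Theory\<close> excludes the null graph; this makes no difference for graphs
  with a non-empty signed degree set.
\<close>

definition connected_signed_graph :: "'a signed_graph \<Rightarrow> bool" where
  "connected_signed_graph S \<longleftrightarrow> is_signed_graph S \<and> connected (with_proj (underlying S))"

end

theory Submission
  imports Defs
begin

text \<open>
  A vertex of signed degree \<open>Min D\<close> is incident with at least \<open>\<bar>Min D\<bar>\<close> negative edges, which lead to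
  as many distinct neighbours; hence the order is at least \<open>\<bar>Min D\<bar> + 1\<close>.  For the converse it
  suffices to make every edge negative, because then signed degrees are negated degrees.  What
  remains is the theorem of Kapoor, Polimeni and Wall that every non-empty finite set \<open>D\<close> of positive
  integers is the degree set of a simple graph of order \<open>Max D + 1\<close>.  In such a graph a
  vertex of degree \<open>Max D\<close> is adjacent to all other vertices, so connectedness comes for free.

  The degree set theorem (\<open>realizable_degree_set\<close>) is proved by induction on \<open>card D\<close> through
  complementation.  Let \<open>m = Max D\<close>.  Complementing a graph of order \<open>m + 1\<close> turns degree
  \<open>d\<close> into \<open>m - d\<close>, so one looks for a graph of order \<open>m + 1\<close> with degree set
  \<open>{m - d | d \<in> D}\<close>.  This set contains \<open>0\<close>, because \<open>m \<in> D\<close>; its non-zero elements form a smaller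
  set whose maximum is less than \<open>m\<close>, since \<open>0 \<notin> D\<close>.  If that set is empty, the edgeless
  graph will do.  Otherwise the induction hypothesis realizes it with fewer than \<open>m + 1\<close> vertices, and
  adding isolated vertices up to order \<open>m + 1\<close> supplies the degree \<open>0\<close>.
\<close>

section \<open>Degree sets of simple graphs\<close>

definition adjacency_on :: "'a set \<Rightarrow> 'a rel \<Rightarrow> bool" where
  "adjacency_on V R \<longleftrightarrow> R \<subseteq> V \<times> V \<and> sym R \<and> irrefl R"

definition degree_set :: "'a set \<Rightarrow> 'a rel \<Rightarrow> nat set" where
  "degree_set V R = (\<lambda>v. card (R `` {v})) ` V"

lemma adjacency_on_empty: "adjacency_on V {}"
  by (simp add: adjacency_on_def sym_def irrefl_def)

lemma degree_set_empty: "V \<noteq> {} \<Longrightarrow> degree_set V {} = {0}"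
  by (auto simp: degree_set_def)

lemma adjacency_on_mono: "adjacency_on V R \<Longrightarrow> V \<subseteq> W \<Longrightarrow> adjacency_on W R"
  by (auto simp: adjacency_on_def)

lemma degree_set_isolated_vertices:
  assumes "adjacency_on V R" and "V \<subset> W"
  shows "degree_set W R = insert 0 (degree_set V R)"
proof -
  have isolated: "card (R `` {v}) = 0" if "v \<in> W - V" for v
  proof -
    have "R `` {v} = {}"
      using assms(1) that by (auto simp: adjacency_on_def)
    then show ?thesis by simp
  qed
  have "W = V \<union> (W - V)" and "W - V \<noteq> {}"
    using assms(2) by auto
  then have "degree_set W R = degree_set V R \<union> (\<lambda>v. card (R `` {v})) ` (W - V)"
    unfolding degree_set_def by (metis image_Un)
  also have "(\<lambda>v. card (R `` {v})) ` (W - V) = (\<lambda>v. 0) ` (W - V)"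
    by (rule image_cong) (simp_all only: isolated)
  also have "\<dots> = {0}"
    using \<open>W - V \<noteq> {}\<close> by auto
  finally show ?thesis by simp
qed

lemma complement_realizes:
  assumes "finite V" and R: "adjacency_on V R"
  obtains C where "adjacency_on V C"
    and "degree_set V C = (\<lambda>d. card V - 1 - d) ` degree_set V R"
proof
  let ?C = "{(u, v). u \<in> V \<and> v \<in> V \<and> u \<noteq> v \<and> (u, v) \<notin> R}"
  show "adjacency_on V ?C"
    using R by (auto simp: adjacency_on_def sym_def irrefl_def)
  have "card (?C `` {v}) = card V - 1 - card (R `` {v})" if "v \<in> V" for v
  proof -
    have "?C `` {v} = (V - {v}) - R `` {v}"
      using that by auto
    moreover have "R `` {v} \<subseteq> V - {v}"
      using R by (auto simp: adjacency_on_def irrefl_def)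
    ultimately show ?thesis
      using assms(1) that by (simp add: card_Diff_subset finite_subset)
  qed
  then show "degree_set V ?C = (\<lambda>d. card V - 1 - d) ` degree_set V R"
    unfolding degree_set_def image_image by (rule image_cong[OF refl])
qed

text \<open>
  The theorem of Kapoor, Polimeni and Wall.  Tying the order to \<open>Max D\<close> is what makes the
  induction work: since \<open>Max E < m\<close> for the set \<open>E\<close> of non-zero degrees in the complement,
  a realization of \<open>E\<close> leaves at least one of the vertices \<open>0, \<dots>, m\<close> isolated.  The same
  order makes a vertex of maximum degree universal.
\<close>

lemma realizable_degree_set:
  fixes D :: "nat set"
  assumes "finite D" and "D \<noteq> {}" and "0 \<notin> D"
  shows "\<exists>R. adjacency_on {..Max D} R \<and> degree_set {..Max D} R = D"
  using assms
proof (induction "card D" arbitrary: D rule: less_induct)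
  case less
  define m where "m = Max D"
  define E where "E = (\<lambda>d. m - d) ` D - {0}"
  have "m \<in> D" and le_m: "\<And>d. d \<in> D \<Longrightarrow> d \<le> m"
    using less.prems by (simp_all add: m_def)
  \<comment> \<open>Of all elements of \<open>D\<close>, only \<open>m\<close> yields \<open>0\<close>; this is where the cardinality drops.\<close>
  have E_alt: "E = (\<lambda>d. m - d) ` (D - {m})"
    using le_m by (force simp: E_def)
  have "finite E" and "0 \<notin> E"
    using less.prems by (simp_all add: E_def)
  have "m > 0"
    using \<open>m \<in> D\<close> less.prems by (metis gr0I)
  have "\<exists>H. adjacency_on {..m} H \<and> degree_set {..m} H = insert 0 E"
  proof (cases "E = {}")
    case True
    then show ?thesis
      using adjacency_on_empty degree_set_empty[of "{..m}"] by auto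
  next
    case False
    have "card E \<le> card (D - {m})"
      unfolding E_alt using less.prems by (simp add: card_image_le)
    also have "\<dots> < card D"
      using less.prems \<open>m \<in> D\<close> by (simp add: card_gt_0_iff)
    finally obtain H where H: "adjacency_on {..Max E} H" "degree_set {..Max E} H = E"
      using less.hyps[of E] False \<open>finite E\<close> \<open>0 \<notin> E\<close> by blast
    have "Max E \<in> E"
      using False \<open>finite E\<close> by simp
    then obtain d where "d \<in> D" "Max E = m - d"
      unfolding E_def by blast
    moreover from this have "d > 0"
      using less.prems by (metis gr0I)
    ultimately have "Max E < m"
      using \<open>m > 0\<close> by simp
    then have "{..Max E} \<subset> {..m}" by auto
    then show ?thesis
      using H adjacency_on_mono degree_set_isolated_vertices[OF H(1)] by blast
  qed
  then obtain H where H: "adjacency_on {..m} H" "degree_set {..m} H = insert 0 E"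
    by blast
  obtain C where C: "adjacency_on {..m} C" "degree_set {..m} C = (\<lambda>d. m - d) ` insert 0 E"
    using complement_realizes[OF finite_atMost H(1)] H(2) by auto
  have "insert 0 E = (\<lambda>d. m - d) ` D"
    using \<open>m \<in> D\<close> by (force simp: E_def)
  then have "(\<lambda>d. m - d) ` insert 0 E = (\<lambda>d. m - (m - d)) ` D"
    by (simp add: image_image)
  also have "\<dots> = D"
    using le_m by simp
  finally show ?case
    using C unfolding m_def by auto
qed

lemma degree_eq_order_minus_1_imp_universal:
  assumes "finite V" and "adjacency_on V R" and "v \<in> V" and "card (R `` {v}) = card V - 1"
  shows "R `` {v} = V - {v}"
  using assms by (intro card_subset_eq) (auto simp: adjacency_on_def irrefl_def)

section \<open>Signed degrees and degrees\<close>

text \<open>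
  In a loop-free symmetric relation, sending a neighbour \<open>u\<close> of \<open>v\<close> to \<open>{v, u}\<close> is a bijection onto
  the edges at \<open>v\<close>.  So edges at \<open>v\<close> may be counted as neighbours.
\<close>

lemma (in pair_graph) card_incident_edges:
  assumes "underlying S = G"
  shows "card {e \<in> edges S. v \<in> e} = card (parcs G `` {v})"
proof -
  have sym: "(y, x) \<in> parcs G" if "(x, y) \<in> parcs G" for x y
    using that sym_arcs by (auto simp: symmetric_def sym_def)
  have "{e \<in> edges S. v \<in> e} = (\<lambda>u. {v, u}) ` (parcs G `` {v})"
    using sym by (auto simp: edges_def assms insert_commute)
  moreover have "inj_on (\<lambda>u. {v, u}) (parcs G `` {v})"
    by (auto simp: inj_on_def doubleton_eq_iff)
  ultimately show ?thesis by (simp add: card_image)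
qed

text \<open>
  Already the negative edges at \<open>v\<close>, of which there are at least \<open>- sdeg S v\<close>, need that many
  vertices other than \<open>v\<close>.
\<close>

lemma order_bound_of_sdeg:
  assumes "is_signed_graph S" and "v \<in> vertices S"
  shows "1 - sdeg S v \<le> int (graph_order S)"
proof -
  interpret pair_graph "underlying S"
    using assms(1) by (simp add: is_signed_graph_def)
  have "edges S \<subseteq> Pow (vertices S)"
    by (auto simp: edges_def vertices_def dest: in_arcsD1 in_arcsD2)
  then have "finite (edges S)"
    using pair_finite_verts by (auto simp: vertices_def intro: finite_subset)
  then have "card {e \<in> edges S. v \<in> e \<and> sign S e = Negative} \<le> card {e \<in> edges S. v \<in> e}"
    by (intro card_mono) auto
  also have "\<dots> = card (parcs (underlying S) `` {v})"
    by (simp add: card_incident_edges)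
  also have "\<dots> \<le> card (vertices S - {v})"
    using pair_finite_verts
    by (intro card_mono) (auto simp: vertices_def dest: in_arcsD2 no_loops')
  also have "\<dots> = graph_order S - 1"
    using assms(2) by (simp add: graph_order_def)
  finally have *: "card {e \<in> edges S. v \<in> e \<and> sign S e = Negative} \<le> graph_order S - 1" .
  have "graph_order S > 0"
    using assms(2) pair_finite_verts by (auto simp: graph_order_def vertices_def card_gt_0_iff)
  with * show ?thesis by (simp add: sdeg_def)
qed

definition all_negative :: "'a set \<Rightarrow> 'a rel \<Rightarrow> 'a signed_graph" where
  "all_negative V R = \<lparr>underlying = \<lparr>pverts = V, parcs = R\<rparr>, sign = (\<lambda>_. Negative)\<rparr>"

lemma vertices_all_negative: "vertices (all_negative V R) = V"
  by (simp add: vertices_def all_negative_def)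

lemma pair_graph_adjacency:
  assumes "finite V" and "adjacency_on V R"
  shows "pair_graph \<lparr>pverts = V, parcs = R\<rparr>"
proof
  show "finite (parcs \<lparr>pverts = V, parcs = R\<rparr>)"
    using assms by (auto simp: adjacency_on_def intro: finite_subset)
qed (use assms in \<open>auto simp: adjacency_on_def symmetric_def irrefl_def\<close>)

lemma sdeg_all_negative:
  assumes "finite V" and "adjacency_on V R"
  shows "sdeg (all_negative V R) v = - int (card (R `` {v}))"
  using pair_graph.card_incident_edges[OF pair_graph_adjacency[OF assms], of "all_negative V R" v]
  by (simp add: sdeg_def all_negative_def)

lemma signed_degree_set_all_negative:
  assumes "finite V" and "adjacency_on V R"
  shows "signed_degree_set (all_negative V R) = (\<lambda>d. - int d) ` degree_set V R"
  by (simp add: signed_degree_set_def degree_set_def vertices_all_negative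
      sdeg_all_negative[OF assms] image_image)

text \<open>
  Any two vertices are joined by a walk through the universal vertex \<open>v\<close>.
\<close>

lemma connected_all_negative:
  assumes "finite V" and R: "adjacency_on V R" and "v \<in> V" and universal: "R `` {v} = V - {v}"
  shows "connected_signed_graph (all_negative V R)"
proof -
  let ?G = "\<lparr>pverts = V, parcs = R\<rparr>"
  interpret pair_graph ?G
    using assms(1,2) by (rule pair_graph_adjacency)
  have from_v: "v \<rightarrow>\<^sup>*\<^bsub>with_proj ?G\<^esub> u" if "u \<in> V" for u
  proof (cases "u = v")
    case False
    then have "u \<in> R `` {v}"
      using that universal by blast
    then show ?thesis by (intro reachable_adjI) simp
  next
    case True
    then show ?thesis
      using that by (simp add: reachable_def)
  qed
  have to_v: "u \<rightarrow>\<^sup>*\<^bsub>with_proj ?G\<^esub> v" if "u \<in> V" for u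
    using symmetric_reachable[OF sym_arcs from_v[OF that]] .
  have "u \<rightarrow>\<^sup>*\<^bsub>with_proj ?G\<^esub> w" if "u \<in> V" "w \<in> V" for u w
    using to_v[OF that(1)] from_v[OF that(2)] by (rule reachable_trans)
  then have "connected (with_proj ?G)"
    using \<open>v \<in> V\<close> unfolding connected_def
    by (intro strongly_connectedI) (auto intro: reachable_mk_symmetricI)
  then show ?thesis
    using pair_graph_axioms
    by (simp add: connected_signed_graph_def is_signed_graph_def all_negative_def)
qed

section \<open>Signed degree sets of negative integers\<close>

theorem theorem2p2:
  fixes D :: "int set"
  assumes "finite D" and "D \<noteq> {}" and "\<forall>d\<in>D. d < 0"
  shows "(\<exists>S :: nat signed_graph. connected_signed_graph S \<and> signed_degree_set S = D) \<and>
         (\<exists>S :: nat signed_graph. connected_signed_graph S \<and> signed_degree_set S = D \<and>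
            int (graph_order S) = \<bar>Min D\<bar> + 1) \<and>
         (\<forall>S :: 'a signed_graph. connected_signed_graph S \<and> signed_degree_set S = D \<longrightarrow>
            \<bar>Min D\<bar> + 1 \<le> int (graph_order S))"
proof -
  define A where "A = (\<lambda>d. nat (- d)) ` D"
  have "Min D \<in> D"
    using assms by simp
  then have "Min D < 0"
    using assms by simp
  have A: "finite A" "A \<noteq> {}" "0 \<notin> A"
    using assms by (auto simp: A_def)
  have D_eq: "D = (\<lambda>a. - int a) ` A"
    using assms(3) by (force simp: A_def image_image)
  have "Max A = nat (- Min D)"
  proof (rule Max_eqI)
    show "a \<le> nat (- Min D)" if "a \<in> A" for a
      using that assms(1) by (auto simp: A_def intro!: nat_mono)
    show "nat (- Min D) \<in> A"
      unfolding A_def using \<open>Min D \<in> D\<close> by (rule imageI)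
  qed (use A in simp)
  then have Max_A: "int (Max A) = \<bar>Min D\<bar>"
    using \<open>Min D < 0\<close> by simp
  obtain R where R: "adjacency_on {..Max A} R" "degree_set {..Max A} R = A"
    using realizable_degree_set[OF A] by blast
  let ?S = "all_negative {..Max A} R"
  have "Max A \<in> degree_set {..Max A} R"
    using R(2) A by simp
  then obtain v where "v \<in> {..Max A}" "card (R `` {v}) = Max A"
    by (auto simp: degree_set_def)
  moreover from this have "R `` {v} = {..Max A} - {v}"
    using R(1) by (intro degree_eq_order_minus_1_imp_universal) simp_all
  ultimately have "connected_signed_graph ?S"
    using R(1) by (intro connected_all_negative) simp_all
  moreover have "signed_degree_set ?S = D"
    using R by (simp add: signed_degree_set_all_negative D_eq)
  moreover have "int (graph_order ?S) = \<bar>Min D\<bar> + 1"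
    by (simp add: graph_order_def vertices_all_negative Max_A)
  moreover have "\<bar>Min D\<bar> + 1 \<le> int (graph_order S)"
    if S: "connected_signed_graph S" "signed_degree_set S = D" for S :: "'a signed_graph"
  proof -
    obtain v where "v \<in> vertices S" "sdeg S v = Min D"
      using S(2) \<open>Min D \<in> D\<close> by (metis signed_degree_set_def imageE)
    then show ?thesis
      using order_bound_of_sdeg[of S v] S(1) \<open>Min D < 0\<close>
      by (simp add: connected_signed_graph_def)
  qed
  ultimately show ?thesis by blast
qed

end
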